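(* Let $\Pi$ be a class of causal policies for the known linear system $x_{t+1}=Ax_t+Bu_t+w_t$ ($x_1=0$) over $T$ rounds. Let $K_0\in\mathbb R^{d_u\times d_x}$ satisfy $\Lambda(K_0)<\infty$. Let a causal reference rule produce $\bar y_t=(\bar x_t,\bar u_t)$, $1\le t\le T$, and let the physical controller be $$u_t=\bar u_t-K_0(x_t-\bar x_t).$$ Let $y_t=(x_t,u_t)$ be the resulting physical trajectory, let $\delta_{t+1}=A\bar x_t+B\bar u_t+w_t-\bar x_{t+1}$ be the one-step reference defect, and let $e_t=x_t-\bar x_t$. Suppose that for every $\pi\in\Pi$ $$\sum_{t=1}^T c_t(\bar y_t)-\sum_{t=1}^T c_t(y_t^\pi)\le R_T(\pi),\qquad \sum_{t=1}^{T-1}\|\delta_{t+1}\|\le D_T^{\rm ref}.$$ If the (convex) costs $c_t$ are globally $L$-Lipschitz and $e_1=0$, then for every $\pi\in\Pi$ $$\sum_{t=1}^T c_t(y_t)-\sum_{t=1}^T c_t(y_t^\pi)\le R_T(\pi)+L\,\Lambda(K_0)\,D_T^{\rm ref}.$$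
   Context: Model: $A\in\mathbb R^{d_x\times d_x}$, $B\in\mathbb R^{d_x\times d_u}$ are known; $x_1=0$ and $x_{t+1}=Ax_t+Bu_t+w_t$ with $\|w_t\|\le W$. On round $t$ the learner observes $x_t$, chooses $u_t$, incurs $c_t(x_t,u_t)$, then observes the whole function $c_t$ and $x_{t+1}$ (hence $w_t$). The environment may choose $c_t,w_t$ as a function of previously revealed history. The inequality is pathwise (it holds for the realized sequence). Policies: a causal policy $\pi$ chooses its action from its own state and the previously revealed costs and disturbances. Its counterfactual trajectory $y_t^\pi=(x_t^\pi,u_t^\pi)$ is obtained by running $\pi$ from $x_1^\pi=0$ on the same realized $(c_t,w_t)$: $x_{t+1}^\pi=Ax_t^\pi+Bu_t^\pi+w_t$. A causal reference rule chooses $\bar y_t=(\bar x_t,\bar u_t)\in\mathbb R^{d_x}\times\mathbb R^{d_u}$ from the history revealed before $c_t$ is observed; it need not satisfy the plant dynamics. Norms: $\|\cdot\|$ is Euclidean, $\|(x,u)\|^2=\|x\|^2+\|u\|^2$. A cost is globally $L$-Lipschitz if $|c_t(y)-c_t(y')|\le L\|y-y'\|$ for all $y,y'$. With $F_0=A-BK_0$, $\Lambda(K_0)=\sum_{r\ge0}\left\|\begin{bmatrix}I\\-K_0\end{bmatrix}F_0^r\right\|_{\rm op}$. *)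

theory Defs
  imports "HOL-Analysis.Analysis"
begin

text \<open>The norm of the product type is \<open>norm (x, u) = sqrt ((norm x)\<^sup>2 + (norm u)\<^sup>2)\<close>,
  the Euclidean norm of the stacked state-action vector.\<close>

type_synonym ('x, 'u) cost = "(real^'x) \<times> (real^'u) \<Rightarrow> real"

text \<open>The action at round \<open>t\<close> is \<open>\<pi> x\<^sub>t [c\<^sub>1, \<dots>, c\<^bsub>t-1\<^esub>] [w\<^sub>1, \<dots>, w\<^bsub>t-1\<^esub>]\<close>; causality is thus
  built into the type, and the round is recoverable from the length of the lists.\<close>

type_synonym ('x, 'u) policy =
  "real^'x \<Rightarrow> ('x, 'u) cost list \<Rightarrow> (real^'x) list \<Rightarrow> real^'u"

text \<open>The reference at round \<open>t\<close> may depend on everything revealed before \<open>c\<^sub>t\<close>: the physical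
  states \<open>x\<^sub>1, \<dots>, x\<^sub>t\<close>, and the actions, costs and disturbances of rounds \<open>1, \<dots>, t - 1\<close>.\<close>

type_synonym ('x, 'u) reference_rule =
  "(real^'x) list \<Rightarrow> (real^'u) list \<Rightarrow> ('x, 'u) cost list \<Rightarrow> (real^'x) list
     \<Rightarrow> (real^'x) \<times> (real^'u)"

text \<open>Values of a sequence at rounds \<open>1, \<dots>, t - 1\<close>.\<close>

definition before :: "(nat \<Rightarrow> 'a) \<Rightarrow> nat \<Rightarrow> 'a list"
  where "before f t = map f [1..<t]"

text \<open>Counterfactual run on the realized costs and disturbances. Rounds start at 1;
  the value at index 0 is a dummy.\<close>

fun policy_state ::
  "real^'x^'x \<Rightarrow> real^'u^'x \<Rightarrow> (nat \<Rightarrow> ('x::finite, 'u::finite) cost) \<Rightarrow> (nat \<Rightarrow> real^'x)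
     \<Rightarrow> ('x, 'u) policy \<Rightarrow> nat \<Rightarrow> real^'x"
where
  "policy_state A B c w \<pi> 0 = 0"
| "policy_state A B c w \<pi> (Suc 0) = 0"
| "policy_state A B c w \<pi> (Suc (Suc s)) =
     (let t = Suc s; x = policy_state A B c w \<pi> t
      in A *v x + B *v \<pi> x (before c t) (before w t) + w t)"

definition policy_traj ::
  "real^'x^'x \<Rightarrow> real^'u^'x \<Rightarrow> (nat \<Rightarrow> ('x::finite, 'u::finite) cost) \<Rightarrow> (nat \<Rightarrow> real^'x)
     \<Rightarrow> ('x, 'u) policy \<Rightarrow> nat \<Rightarrow> (real^'x) \<times> (real^'u)"
where
  "policy_traj A B c w \<pi> t =
     (let x = policy_state A B c w \<pi> t in (x, \<pi> x (before c t) (before w t)))"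

text \<open>The \<open>r\<close>-th term is the operator norm of the block matrix with rows \<open>F\<^sup>r\<close> and \<open>- K\<^sub>0 F\<^sup>r\<close>,
  where \<open>F = A - B K\<^sub>0\<close>. The power is an iterate of the linear map, since \<open>^\<close> and \<open>*\<close> on vectors
  are componentwise. The sum is extended-valued, so finiteness is a genuine condition.\<close>

definition Lambda :: "real^'x^'x \<Rightarrow> real^'u^'x \<Rightarrow> real^'x^'u \<Rightarrow> ennreal"
where
  "Lambda A B K\<^sub>0 =
     (\<Sum>r. ennreal (onorm (\<lambda>v. let z = (((*v) (A - B ** K\<^sub>0)) ^^ r) v in (z, - (K\<^sub>0 *v z)))))"

end

theory Submission
  imports Defs
begin

text \<open>The tracking error \<open>e\<^sub>t = x\<^sub>t - xbar\<^sub>t\<close> obeys \<open>e\<^bsub>t+1\<^esub> = (A - B K\<^sub>0) e\<^sub>t + \<delta>\<^bsub>t+1\<^esub>\<close>, so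
  \<open>y\<^sub>t - ybar\<^sub>t = (e\<^sub>t, - K\<^sub>0 e\<^sub>t)\<close> is the convolution of the defects with the maps whose operator norms
  add up to \<open>Lambda\<close>. By Young's inequality for convolutions its norms sum to at most
  \<open>Lambda\<close> times the total defect, and the Lipschitz bound transfers this to the costs.\<close>

lemma linear_funpow:
  fixes f :: "'a::real_vector \<Rightarrow> 'a"
  assumes "linear f"
  shows "linear (f ^^ n)"
proof (induction n)
  case 0
  show ?case by (simp add: linear_iff)
next
  case (Suc n)
  then show ?case using assms by (simp add: linear_iff)
qed

text \<open>Discrete variation of constants from a zero start: applying \<open>f\<close> once more
  raises every exponent by one, while the newest input \<open>d t\<close> enters with exponent 0.
  The input \<open>d s\<close> first acts at time \<open>Suc s\<close>, hence the exponent
  \<open>t - Suc s\<close>.\<close>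

lemma affine_recursion_solution:
  fixes f :: "'a::real_vector \<Rightarrow> 'a" and e d :: "nat \<Rightarrow> 'a"
  assumes "linear f" and "e 1 = 0"
    and "\<And>t. t \<in> {1..<T} \<Longrightarrow> e (Suc t) = f (e t) + d t"
    and "t \<in> {1..T}"
  shows "e t = (\<Sum>s\<in>{1..<t}. (f ^^ (t - Suc s)) (d s))"
  using assms(4)
proof (induction t)
  case 0
  then show ?case by simp
next
  case (Suc t)
  show ?case
  proof (cases "t = 0")
    case True
    then show ?thesis using assms(2) by simp
  next
    case False
    \<comment> \<open>Here \<open>s < t\<close> matters: only then does truncated subtraction give
      \<open>t - s = Suc (t - Suc s)\<close>.\<close>
    have "f ((f ^^ (t - Suc s)) (d s)) = (f ^^ (t - s)) (d s)" if "s \<in> {1..<t}" for s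
      using that by (simp flip: Suc_diff_Suc)
    then have "f (e t) = (\<Sum>s\<in>{1..<t}. (f ^^ (t - s)) (d s))"
      using Suc False by (simp add: linear_sum[OF assms(1)])
    then show ?thesis
      using assms(3)[of t] Suc.prems False by simp
  qed
qed

text \<open>After exchanging the two sums, each \<open>d s\<close> is multiplied by a partial sum of
  \<open>g\<close>, so a uniform bound on partial sums suffices.\<close>

lemma convolution_sum_le:
  fixes g d :: "nat \<Rightarrow> real"
  assumes g_nonneg: "\<And>r. 0 \<le> g r" and d_nonneg: "\<And>s. 0 \<le> d s"
    and g_sum: "\<And>n. (\<Sum>r<n. g r) \<le> M"
  shows "(\<Sum>t=1..T. \<Sum>s\<in>{1..<t}. g (t - Suc s) * d s) \<le> M * (\<Sum>s=1..T-1. d s)"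
proof -
  have inner: "(\<Sum>t\<in>{Suc s..T}. g (t - Suc s) * d s) \<le> M * d s" for s
  proof -
    have "(\<Sum>t\<in>{Suc s..T}. g (t - Suc s)) = (\<Sum>r<T - s. g r)"
      by (rule sum.reindex_bij_witness[of _ "\<lambda>r. r + Suc s" "\<lambda>t. t - Suc s"]) auto
    then show ?thesis
      using g_sum d_nonneg by (simp add: mult_right_mono flip: sum_distrib_right)
  qed
  \<comment> \<open>Both sides run over the triangle \<open>1 \<le> s < t \<le> T\<close>, so
    \<open>s\<close> stops at \<open>T-1\<close>, exactly where the sum of defects stops.\<close>
  have "(\<Sum>t=1..T. \<Sum>s\<in>{1..<t}. g (t - Suc s) * d s)
      = (\<Sum>s=1..T-1. \<Sum>t\<in>{Suc s..T}. g (t - Suc s) * d s)"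
    by (simp add: sum.Sigma, rule sum.reindex_bij_witness[of _ prod.swap prod.swap]) auto
  also have "\<dots> \<le> (\<Sum>s=1..T-1. M * d s)"
    by (intro sum_mono inner)
  finally show ?thesis by (simp add: sum_distrib_left)
qed

theorem theorem3p1:
  fixes A :: "real^'x^'x" and B :: "real^'u^'x" and K\<^sub>0 :: "real^'x^'u"
    and T :: nat and W L D :: real
    and c :: "nat \<Rightarrow> ('x::finite, 'u::finite) cost" and w :: "nat \<Rightarrow> real^'x"
    and \<P> :: "('x, 'u) policy set" and R :: "('x, 'u) policy \<Rightarrow> real"
    and ref :: "('x, 'u) reference_rule"
    and x xbar :: "nat \<Rightarrow> real^'x" and u ubar :: "nat \<Rightarrow> real^'u"
  assumes disturbance: "\<forall>t\<in>{1..T}. norm (w t) \<le> W"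
    and costs_convex: "\<forall>t\<in>{1..T}. convex_on UNIV (c t)"
    and L_nonneg: "0 \<le> L"
    and costs_lipschitz: "\<forall>t\<in>{1..T}. L-lipschitz_on UNIV (c t)"
    and Lambda_finite: "Lambda A B K\<^sub>0 < \<infinity>"
    and initial: "x 1 = 0"
    and plant: "\<forall>t\<in>{1..T}. x (t + 1) = A *v x t + B *v u t + w t"
    and reference: "\<forall>t\<in>{1..T}.
          (xbar t, ubar t) = ref (before x (t + 1)) (before u t) (before c t) (before w t)"
    and controller: "\<forall>t\<in>{1..T}. u t = ubar t - K\<^sub>0 *v (x t - xbar t)"
    and initial_error: "x 1 - xbar 1 = 0"
    and reference_regret: "\<forall>\<pi>\<in>\<P>.
          (\<Sum>t=1..T. c t (xbar t, ubar t)) - (\<Sum>t=1..T. c t (policy_traj A B c w \<pi> t)) \<le> R \<pi>"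
    and reference_defect:
          "(\<Sum>t=1..T-1. norm (A *v xbar t + B *v ubar t + w t - xbar (t + 1))) \<le> D"
  shows "\<forall>\<pi>\<in>\<P>.
          (\<Sum>t=1..T. c t (x t, u t)) - (\<Sum>t=1..T. c t (policy_traj A B c w \<pi> t))
            \<le> R \<pi> + L * enn2real (Lambda A B K\<^sub>0) * D"
proof -
  define F where "F = (*v) (A - B ** K\<^sub>0)"
  \<comment> \<open>\<open>onorm (G r)\<close> is the \<open>r\<close>-th term of the series
    \<open>Lambda\<close>.\<close>
  define G where "G = (\<lambda>r v. ((F ^^ r) v, - (K\<^sub>0 *v (F ^^ r) v)))"
  define e where "e = (\<lambda>t. x t - xbar t)"
  \<comment> \<open>The index is that of the round in which the defect arises:
    \<open>\<delta> t\<close> is the defect at the passage from \<open>t\<close> to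
    \<open>t + 1\<close>.\<close>
  define \<delta> where "\<delta> = (\<lambda>t. A *v xbar t + B *v ubar t + w t - xbar (t + 1))"
  have lin_F: "linear F"
    unfolding F_def by simp
  have lin_G: "linear (G r)" for r
  proof -
    note lin = linear_funpow[OF lin_F, of r]
    show ?thesis unfolding G_def
      by (rule linearI)
        (simp_all add: linear_add[OF lin] linear_scale[OF lin]
          matrix_vector_right_distrib matrix_vector_mult_scaleR)
  qed
  have bl_G: "bounded_linear (G r)" for r
    by (simp add: lin_G linear_conv_bounded_linear[symmetric])
  \<comment> \<open>Finiteness of \<open>Lambda\<close> is essential: \<open>enn2real\<close> sends
    infinity to 0, and is monotone only below it.\<close>
  have onorm_sum: "(\<Sum>r<n. onorm (G r)) \<le> enn2real (Lambda A B K\<^sub>0)" for n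
  proof -
    have "ennreal (\<Sum>r<n. onorm (G r)) = (\<Sum>r<n. ennreal (onorm (G r)))"
      using onorm_pos_le[OF bl_G] by simp
    also have "\<dots> \<le> Lambda A B K\<^sub>0"
      unfolding Lambda_def G_def F_def Let_def by (rule sum_le_suminf) auto
    finally show ?thesis
      using Lambda_finite onorm_pos_le[OF bl_G]
      by (metis enn2real_ennreal enn2real_mono infinity_ennreal_def sum_nonneg)
  qed
  \<comment> \<open>Insert the controller into the plant and write \<open>x t\<close> as
    \<open>xbar t + e t\<close>; the terms without \<open>e t\<close> form the defect.\<close>
  have recursion: "e (Suc t) = F (e t) + \<delta> t" if "t \<in> {1..<T}" for t
    using that plant controller unfolding e_def F_def \<delta>_def
    by (simp add: matrix_vector_mult_diff_distrib matrix_vector_mult_diff_rdistrib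
        matrix_vector_mul_assoc)
  have tracking: "norm ((x t, u t) - (xbar t, ubar t))
      \<le> (\<Sum>s\<in>{1..<t}. onorm (G (t - Suc s)) * norm (\<delta> s))" if t: "t \<in> {1..T}" for t
  proof -
    have e_t: "e t = (\<Sum>s\<in>{1..<t}. (F ^^ (t - Suc s)) (\<delta> s))"
      using initial_error
      by (intro affine_recursion_solution[where T = T] lin_F recursion t) (simp_all add: e_def)
    \<comment> \<open>The controller makes the action error a linear image of the state error, so
      one sum of the \<open>G\<close> terms covers both components.\<close>
    have "(x t, u t) - (xbar t, ubar t) = (e t, - (K\<^sub>0 *v e t))"
      using controller t by (simp add: e_def)
    also have "\<dots> = (\<Sum>s\<in>{1..<t}. G (t - Suc s) (\<delta> s))"
      unfolding e_t G_def by (simp add: sum_prod sum_negf linear_sum[OF matrix_vector_mul_linear])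
    finally show ?thesis
      using onorm[OF bl_G] by (auto intro: sum_norm_le)
  qed
  have "(\<Sum>t=1..T. c t (x t, u t)) - (\<Sum>t=1..T. c t (xbar t, ubar t))
      = (\<Sum>t=1..T. c t (x t, u t) - c t (xbar t, ubar t))"
    by (simp add: sum_subtractf)
  also have "\<dots> \<le> (\<Sum>t=1..T. L * norm ((x t, u t) - (xbar t, ubar t)))"
  proof (rule sum_mono)
    fix t assume "t \<in> {1..T}"
    then have "dist (c t (x t, u t)) (c t (xbar t, ubar t)) \<le> L * dist (x t, u t) (xbar t, ubar t)"
      using costs_lipschitz by (blast intro: lipschitz_onD)
    then show "c t (x t, u t) - c t (xbar t, ubar t) \<le> L * norm ((x t, u t) - (xbar t, ubar t))"
      by (simp add: dist_norm)
  qed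
  also have "\<dots> \<le> L * (\<Sum>t=1..T. \<Sum>s\<in>{1..<t}. onorm (G (t - Suc s)) * norm (\<delta> s))"
    unfolding sum_distrib_left[symmetric] using L_nonneg tracking
    by (intro mult_left_mono sum_mono)
  also have "\<dots> \<le> L * (enn2real (Lambda A B K\<^sub>0) * (\<Sum>s=1..T-1. norm (\<delta> s)))"
    using L_nonneg onorm_sum onorm_pos_le[OF bl_G]
    by (intro mult_left_mono convolution_sum_le) auto
  also have "\<dots> \<le> L * (enn2real (Lambda A B K\<^sub>0) * D)"
    using L_nonneg reference_defect unfolding \<delta>_def by (intro mult_left_mono) auto
  \<comment> \<open>The cost gap between physical and reference trajectories does not involve
    \<open>\<pi>\<close>; adding the reference regret of each \<open>\<pi>\<close> gives the
    claim.\<close>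
  finally show ?thesis
    using reference_regret by (fastforce simp: mult.assoc)
qed

end
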